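(* Let $f:\mathbb{R}^2\to\mathbb{R}^2$ be a $C^1$ map. Then $J(f)$ is unipotent if $f$ is of the form $$f(x,y)=\bigl(x+b\,\phi(ax+by)+c,\; y-a\,\phi(ax+by)+d\bigr)$$ for some constants $a,b,c,d\in\mathbb{R}$ and some function $\phi$ of a single variable. If that is the case, then $f$ has an explicit global inverse. Conversely, if $f$ is $C^1$ and $J(f)$ is unipotent, then $f$ is of the form shown, for a $\phi$ that is $C^1$.
   Context: $J(f)$ denotes the Jacobian matrix of $f$. "$J(f)$ is unipotent" means that at every point of $\mathbb{R}^2$ all eigenvalues of $J(f)$ are $1$, equivalently that $J(f)$ is the sum of the identity matrix and a nilpotent matrix. Here $\phi$ is a real-valued function of one real variable. An inverse is called explicit if it is represented by a finite formula involving algebraic operations, composition, and the functions and constants that appear in the definition of $f$. *)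

theory Defs
  imports "HOL-Analysis.Analysis"
begin

definition C1_map :: "(real^'n \<Rightarrow> real^'m) \<Rightarrow> bool" where
  "C1_map f \<longleftrightarrow>
     (\<forall>p. f differentiable (at p)) \<and> continuous_on UNIV (\<lambda>p. jacobian f (at p))"

text \<open>Eigenvalues of a real matrix are taken over the complex numbers: a real \<open>2 \<times> 2\<close> matrix need
  not have any real eigenvalue.\<close>

definition eigenvalue_of :: "real^'n^'n \<Rightarrow> complex \<Rightarrow> bool" where
  "eigenvalue_of A z \<longleftrightarrow>
     (\<exists>v. v \<noteq> 0 \<and> (\<chi> i j. complex_of_real (A $ i $ j)) *v v = z *s v)"

definition unipotent_jacobian :: "(real^'n \<Rightarrow> real^'n) \<Rightarrow> bool" where
  "unipotent_jacobian f \<longleftrightarrow> (\<forall>p z. eigenvalue_of (jacobian f (at p)) z \<longrightarrow> z = 1)"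

definition shear_form ::
  "real \<Rightarrow> real \<Rightarrow> real \<Rightarrow> real \<Rightarrow> (real \<Rightarrow> real) \<Rightarrow> real^2 \<Rightarrow> real^2" where
  "shear_form a b c d \<phi> p =
     vector [p $ 1 + b * \<phi> (a * p $ 1 + b * p $ 2) + c,
             p $ 2 - a * \<phi> (a * p $ 1 + b * p $ 2) + d]"

text \<open>The functions given by a finite formula in the coordinates, built by algebraic operations and
  composition from the constants in \<open>C\<close> and the functions in \<open>F\<close>. Denominators must vanish nowhere,
  so that the convention \<open>x / 0 = 0\<close> cannot be used to obtain case distinctions.\<close>

inductive explicit_fun ::
  "real set \<Rightarrow> (real \<Rightarrow> real) set \<Rightarrow> (real^'n \<Rightarrow> real) \<Rightarrow> bool" for C F where
  coord: "explicit_fun C F (\<lambda>p. p $ i)"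
| const: "k \<in> C \<Longrightarrow> explicit_fun C F (\<lambda>p. k)"
| add: "\<lbrakk>explicit_fun C F g; explicit_fun C F h\<rbrakk> \<Longrightarrow> explicit_fun C F (\<lambda>p. g p + h p)"
| diff: "\<lbrakk>explicit_fun C F g; explicit_fun C F h\<rbrakk> \<Longrightarrow> explicit_fun C F (\<lambda>p. g p - h p)"
| mult: "\<lbrakk>explicit_fun C F g; explicit_fun C F h\<rbrakk> \<Longrightarrow> explicit_fun C F (\<lambda>p. g p * h p)"
| div: "\<lbrakk>explicit_fun C F g; explicit_fun C F h; \<And>p. h p \<noteq> 0\<rbrakk> \<Longrightarrow>
        explicit_fun C F (\<lambda>p. g p / h p)"
| comp: "\<lbrakk>\<psi> \<in> F; explicit_fun C F g\<rbrakk> \<Longrightarrow> explicit_fun C F (\<lambda>p. \<psi> (g p))"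

definition explicit_map ::
  "real set \<Rightarrow> (real \<Rightarrow> real) set \<Rightarrow> (real^'n \<Rightarrow> real^'m) \<Rightarrow> bool" where
  "explicit_map C F g \<longleftrightarrow> (\<forall>i. explicit_fun C F (\<lambda>p. g p $ i))"

end

theory Submission
  imports Defs
begin

text \<open>
  That a shear map has a unipotent Jacobian matrix and an explicit inverse rests on one observation:
  \<open>a f\<^sub>1 + b f\<^sub>2\<close> equals \<open>a x + b y\<close> up to a constant, so the argument of \<open>\<phi>\<close> can be read off from the
  image point (\<open>shear_form_unipotent\<close>, \<open>explicit_map_inv_shear_form\<close>).

  For the converse put \<open>H p = f p - p\<close>. Its derivative \<open>N\<close> is nilpotent everywhere. Write
  \<open>H = (P, Q)\<close> and look at a point with \<open>P\<^sub>y \<noteq> 0\<close>. The vanishing determinant says that locally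
  \<open>Q = G(P)\<close>, and the vanishing trace turns into the conservation law \<open>P\<^sub>x + G'(P) P\<^sub>y = 0\<close>. Its
  characteristics, the level curves of \<open>P\<close>, are straight line segments of slope \<open>G'(P)\<close>, pointing in
  the direction of the kernel of \<open>N\<close>. Neighbouring characteristics separate linearly, so
  \<open>1 / P\<^sub>y\<close> is affine along each of them. Hence \<open>P\<^sub>y\<close> cannot tend to 0 at finite distance, and the
  segment extends to a complete line on which \<open>N\<close> is nonzero with constant kernel (\<open>local_line\<close>,
  \<open>kernel_line\<close>). Two such lines cannot cross, because at the crossing a nonzero \<open>N\<close> would kill two
  independent vectors. So all of them are parallel, and one vector \<open>w\<close> lies in the kernel of \<open>N\<close>
  at every point of the plane (\<open>common_kernel_direction\<close>). By nilpotency the image of \<open>N\<close> is contained in the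
  span of \<open>w\<close> too, and integration gives the shear form (\<open>ridge_form\<close>). This is an elementary
  version, for fields of class \<open>C\<^sup>1\<close>, of the fact that a complete developable graph is a cylinder.
\<close>

section \<open>Lines of constancy of a planar field with nilpotent derivative\<close>

text \<open>The derivative is written in coordinates because the argument singles out the variable \<open>y\<close>: it
  works where \<open>P\<^sub>y \<noteq> 0\<close>, and the remaining points are reached by exchanging the two coordinates.\<close>
locale nilpotent_pair =
  fixes P Q Px Py Qx Qy :: "real \<Rightarrow> real \<Rightarrow> real"
  assumes P_deriv:
      "((\<lambda>z. P (fst z) (snd z)) has_derivative (\<lambda>h. Px x y * fst h + Py x y * snd h)) (at (x, y))"
    and Q_deriv:
      "((\<lambda>z. Q (fst z) (snd z)) has_derivative (\<lambda>h. Qx x y * fst h + Qy x y * snd h)) (at (x, y))"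
    and Px_cont: "continuous_on UNIV (\<lambda>z. Px (fst z) (snd z))"
    and Py_cont: "continuous_on UNIV (\<lambda>z. Py (fst z) (snd z))"
    and trace_zero: "Px x y + Qy x y = 0"
    and det_zero: "Px x y * Qy x y = Py x y * Qx x y"
begin

text \<open>Where \<open>P\<^sub>y \<noteq> 0\<close>, the map \<open>(x, y) \<mapsto> (x, P x y)\<close> is a local diffeomorphism, so \<open>x\<close> and the value
  \<open>\<tau>\<close> of \<open>P\<close> are local coordinates. The graph of \<open>\<lambda>x. Y x \<tau>\<close> is then the level curve \<open>P = \<tau>\<close>; the
  formula for the derivative of \<open>Y\<close> is what one gets by differentiating \<open>P x (Y x \<tau>) = \<tau>\<close>.\<close>
lemma local_coordinates:
  assumes "Py x0 y0 \<noteq> 0"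
  obtains \<delta> Y where "\<delta> > 0" "Y x0 (P x0 y0) = y0"
    "\<And>x \<tau>. \<lbrakk>\<bar>x - x0\<bar> < \<delta>; \<bar>\<tau> - P x0 y0\<bar> < \<delta>\<rbrakk> \<Longrightarrow> Py x (Y x \<tau>) \<noteq> 0"
    "\<And>x \<tau>. \<lbrakk>\<bar>x - x0\<bar> < \<delta>; \<bar>\<tau> - P x0 y0\<bar> < \<delta>\<rbrakk> \<Longrightarrow>
       ((\<lambda>z. Y (fst z) (snd z)) has_derivative
        (\<lambda>h. (snd h - Px x (Y x \<tau>) * fst h) / Py x (Y x \<tau>))) (at (x, \<tau>))"
proof -
  define F where "F = (\<lambda>z. (fst z, P (fst z) (snd z)))"
  define A :: "(real \<times> real) \<Rightarrow>\<^sub>L (real \<times> real)" where "A = Blinfun (\<lambda>h. (fst h, 0))"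
  define B :: "(real \<times> real) \<Rightarrow>\<^sub>L (real \<times> real)" where "B = Blinfun (\<lambda>h. (0, fst h))"
  define C :: "(real \<times> real) \<Rightarrow>\<^sub>L (real \<times> real)" where "C = Blinfun (\<lambda>h. (0, snd h))"
  define F' where "F' = (\<lambda>z. A + Px (fst z) (snd z) *\<^sub>R B + Py (fst z) (snd z) *\<^sub>R C)"
  have blA: "blinfun_apply A = (\<lambda>h. (fst h, 0))" and blB: "blinfun_apply B = (\<lambda>h. (0, fst h))"
    and blC: "blinfun_apply C = (\<lambda>h. (0, snd h))"
    unfolding A_def B_def C_def by (auto intro!: bounded_linear_Blinfun_apply bounded_linear_intros)
  have F'_apply: "blinfun_apply (F' (x, y)) = (\<lambda>h. (fst h, Px x y * fst h + Py x y * snd h))" for x y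
    by (auto simp: F'_def blinfun.add_left blinfun.scaleR_left blA blB blC)
  have F_deriv: "(F has_derivative blinfun_apply (F' z)) (at z)" for z
  proof (cases z)
    case (Pair x y)
    show ?thesis
      unfolding Pair F'_apply F_def
      by (intro has_derivative_Pair P_deriv has_derivative_fst has_derivative_ident)
  qed
  have F'_cont: "continuous_on UNIV F'"
    unfolding F'_def by (intro continuous_intros Px_cont Py_cont)
  \<comment> \<open>The inverse of the derivative of \<open>F\<close> at the base point.\<close>
  define I where
    "I = A - (Px x0 y0 / Py x0 y0) *\<^sub>R B + (1 / Py x0 y0) *\<^sub>R C"
  have I: "I o\<^sub>L F' (x0, y0) = id_blinfun"
    using assms
    by (intro blinfun_eqI)
       (auto simp: I_def F'_apply blinfun.add_left blinfun.diff_left blinfun.scaleR_left blA blB blC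
          field_simps prod_eq_iff)
  obtain U V g g' where UV: "open U" "(x0, y0) \<in> U" "open V" "F (x0, y0) \<in> V"
      "homeomorphism U V F g"
      and g: "\<And>z. z \<in> V \<Longrightarrow> (g has_derivative g' z) (at z)"
      and g': "\<And>z. z \<in> V \<Longrightarrow> g' z = inv (blinfun_apply (F' (g z)))"
      and bij: "\<And>z. z \<in> V \<Longrightarrow> bij (blinfun_apply (F' (g z)))"
    using inverse_function_theorem[OF open_UNIV F_deriv F'_cont UNIV_I I] by metis
  define Y where "Y = (\<lambda>x \<tau>. snd (g (x, \<tau>)))"
  have gV: "g (x, \<tau>) = (x, Y x \<tau>)" if "(x, \<tau>) \<in> V" for x \<tau>
  proof -
    have "F (g (x, \<tau>)) = (x, \<tau>)"
      using UV(5) that by (simp add: homeomorphism_def)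
    then show ?thesis
      by (auto simp: F_def Y_def prod_eq_iff)
  qed
  obtain e where e: "e > 0" "ball (F (x0, y0)) e \<subseteq> V"
    using UV(3,4) open_contains_ball by blast
  have box: "(x, \<tau>) \<in> V" if "\<bar>x - x0\<bar> < e / 2" "\<bar>\<tau> - P x0 y0\<bar> < e / 2" for x \<tau>
  proof -
    have "dist (x, \<tau>) (x0, P x0 y0) \<le> dist x x0 + dist \<tau> (P x0 y0)"
      unfolding dist_Pair_Pair by (rule sqrt_sum_squares_le_sum) auto
    also have "\<dots> < e"
      using that by (simp add: dist_real_def)
    finally show ?thesis
      using e(2) by (auto simp: F_def dist_commute subset_iff)
  qed
  have nz: "Py x (Y x \<tau>) \<noteq> 0" if "(x, \<tau>) \<in> V" for x \<tau>
  proof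
    assume "Py x (Y x \<tau>) = 0"
    then have "blinfun_apply (F' (g (x, \<tau>))) (0, 1) = blinfun_apply (F' (g (x, \<tau>))) (0, 0)"
      by (simp add: gV[OF that] F'_apply)
    then show False
      using bij[OF that] by (auto simp: bij_def dest: injD)
  qed
  show thesis
  proof (rule that[of "e / 2" Y])
    show "e / 2 > 0" using e by simp
    have "g (F (x0, y0)) = (x0, y0)"
      using UV(2,5) by (simp add: homeomorphism_def)
    then show "Y x0 (P x0 y0) = y0"
      by (simp add: Y_def F_def)
    fix x \<tau> assume "\<bar>x - x0\<bar> < e / 2" "\<bar>\<tau> - P x0 y0\<bar> < e / 2"
    then have V: "(x, \<tau>) \<in> V" by (rule box)
    show "Py x (Y x \<tau>) \<noteq> 0" by (rule nz[OF V])
    have "inv (blinfun_apply (F' (g (x, \<tau>)))) =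
        (\<lambda>h. (fst h, (snd h - Px x (Y x \<tau>) * fst h) / Py x (Y x \<tau>)))"
      using nz[OF V]
      by (intro inv_unique_comp) (auto simp: gV[OF V] F'_apply fun_eq_iff field_simps)
    then have "((\<lambda>z. snd (g z)) has_derivative
        (\<lambda>h. snd (fst h, (snd h - Px x (Y x \<tau>) * fst h) / Py x (Y x \<tau>)))) (at (x, \<tau>))"
      using g[OF V] g'[OF V] by (intro has_derivative_snd) simp
    then show "((\<lambda>z. Y (fst z) (snd z)) has_derivative
        (\<lambda>h. (snd h - Px x (Y x \<tau>) * fst h) / Py x (Y x \<tau>))) (at (x, \<tau>))"
      by (simp add: Y_def)
  qed
qed

text \<open>In the coordinates \<open>(x, \<tau>)\<close> the determinant condition makes \<open>Q\<close> a function of \<open>\<tau>\<close> alone, and the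
  trace condition makes its derivative in \<open>\<tau>\<close> equal to the slope \<open>Y\<^sub>x = - P\<^sub>x / P\<^sub>y\<close> of the level curve.
  So the slope depends on \<open>\<tau>\<close> only, which means that level curves are straight: \<open>Y x \<tau>\<close> is affine
  in \<open>x\<close>. Its derivative in \<open>\<tau>\<close>, which is \<open>1 / P\<^sub>y\<close>, is then affine in \<open>x\<close> as well. This last fact is
  what later prevents \<open>P\<^sub>y\<close> from tending to 0 along the line.\<close>
lemma local_line:
  assumes "Py x0 y0 \<noteq> 0" and m: "m = - Px x0 y0 / Py x0 y0"
  shows "\<exists>\<delta>>0. \<exists>B. \<forall>x. \<bar>x - x0\<bar> < \<delta> \<longrightarrow>
    Py x (y0 + m * (x - x0)) \<noteq> 0 \<and>
    Px x (y0 + m * (x - x0)) = - m * Py x (y0 + m * (x - x0)) \<and>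
    1 / Py x (y0 + m * (x - x0)) = 1 / Py x0 y0 + B * (x - x0)"
proof -
  define \<tau>0 where "\<tau>0 = P x0 y0"
  obtain \<delta> Y where \<delta>: "\<delta> > 0" and Y0: "Y x0 \<tau>0 = y0"
    and nz: "\<And>x \<tau>. \<lbrakk>\<bar>x - x0\<bar> < \<delta>; \<bar>\<tau> - \<tau>0\<bar> < \<delta>\<rbrakk> \<Longrightarrow> Py x (Y x \<tau>) \<noteq> 0"
    and dY: "\<And>x \<tau>. \<lbrakk>\<bar>x - x0\<bar> < \<delta>; \<bar>\<tau> - \<tau>0\<bar> < \<delta>\<rbrakk> \<Longrightarrow>
       ((\<lambda>z. Y (fst z) (snd z)) has_derivative
        (\<lambda>h. (snd h - Px x (Y x \<tau>) * fst h) / Py x (Y x \<tau>))) (at (x, \<tau>))"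
    by (rule local_coordinates[OF assms(1), folded \<tau>0_def]) auto
  define s where "s = (\<lambda>x \<tau>. - Px x (Y x \<tau>) / Py x (Y x \<tau>))"
  have Y_x: "((\<lambda>x. Y x \<tau>) has_real_derivative s x \<tau>) (at x)"
    if "\<bar>x - x0\<bar> < \<delta>" "\<bar>\<tau> - \<tau>0\<bar> < \<delta>" for x \<tau>
  proof -
    have "((\<lambda>x. (x, \<tau>)) has_derivative (\<lambda>h. (h, 0))) (at x)"
      by (intro has_derivative_Pair has_derivative_ident has_derivative_const)
    from has_derivative_compose[OF this dY[OF that]] show ?thesis
      unfolding has_field_derivative_def fst_conv snd_conv
      by (rule has_derivative_eq_rhs) (auto simp: s_def fun_eq_iff)
  qed
  have Y_t: "((\<lambda>\<tau>. Y x \<tau>) has_real_derivative 1 / Py x (Y x \<tau>)) (at \<tau>)"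
    if "\<bar>x - x0\<bar> < \<delta>" "\<bar>\<tau> - \<tau>0\<bar> < \<delta>" for x \<tau>
  proof -
    have "((\<lambda>\<tau>. (x, \<tau>)) has_derivative (\<lambda>h. (0, h))) (at \<tau>)"
      by (intro has_derivative_Pair has_derivative_ident has_derivative_const)
    from has_derivative_compose[OF this dY[OF that]] show ?thesis
      unfolding has_field_derivative_def fst_conv snd_conv
      by (rule has_derivative_eq_rhs) (auto simp: fun_eq_iff)
  qed
  have Q_x: "((\<lambda>x. Q x (Y x \<tau>)) has_real_derivative 0) (at x)"
    and Q_t: "((\<lambda>\<tau>. Q x (Y x \<tau>)) has_real_derivative s x \<tau>) (at \<tau>)"
    if "\<bar>x - x0\<bar> < \<delta>" "\<bar>\<tau> - \<tau>0\<bar> < \<delta>" for x \<tau>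
  proof -
    let ?y = "Y x \<tau>"
    have Qy: "Qy x ?y = - Px x ?y"
      using trace_zero[of x ?y] by simp
    have Qx: "Qx x ?y = - Px x ?y * Px x ?y / Py x ?y"
      using det_zero[of x ?y] nz[OF that] by (simp add: Qy field_simps)
    have "((\<lambda>x. (x, Y x \<tau>)) has_derivative (\<lambda>h. (h, s x \<tau> * h))) (at x)"
      using Y_x[OF that] unfolding has_field_derivative_def
      by (intro has_derivative_Pair has_derivative_ident)
    from has_derivative_compose[OF this Q_deriv]
    have "((\<lambda>x. Q x (Y x \<tau>)) has_derivative (\<lambda>h. Qx x ?y * h + Qy x ?y * (s x \<tau> * h))) (at x)"
      by simp
    moreover have "(\<lambda>h. Qx x ?y * h + Qy x ?y * (s x \<tau> * h)) = (*) 0"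
      using nz[OF that] by (auto simp: fun_eq_iff Qx Qy s_def field_simps)
    ultimately show "((\<lambda>x. Q x (Y x \<tau>)) has_real_derivative 0) (at x)"
      unfolding has_field_derivative_def by simp
    have "((\<lambda>\<tau>. (x, Y x \<tau>)) has_derivative (\<lambda>h. (0, 1 / Py x ?y * h))) (at \<tau>)"
      using Y_t[OF that] unfolding has_field_derivative_def
      by (intro has_derivative_Pair has_derivative_const)
    from has_derivative_compose[OF this Q_deriv]
    have "((\<lambda>\<tau>. Q x (Y x \<tau>)) has_derivative (\<lambda>h. Qy x ?y * (1 / Py x ?y * h))) (at \<tau>)"
      by simp
    moreover have "(\<lambda>h. Qy x ?y * (1 / Py x ?y * h)) = (*) (s x \<tau>)"
      by (auto simp: fun_eq_iff Qx Qy s_def field_simps)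
    ultimately show "((\<lambda>\<tau>. Q x (Y x \<tau>)) has_real_derivative s x \<tau>) (at \<tau>)"
      unfolding has_field_derivative_def by simp
  qed
  define X where "X = {x0 - \<delta> <..< x0 + \<delta>}"
  define T where "T = {\<tau>0 - \<delta> <..< \<tau>0 + \<delta>}"
  have X: "x \<in> X \<longleftrightarrow> \<bar>x - x0\<bar> < \<delta>" and T: "\<tau> \<in> T \<longleftrightarrow> \<bar>\<tau> - \<tau>0\<bar> < \<delta>" for x \<tau>
    by (auto simp: X_def T_def)
  have convX: "convex X" and openT: "open T" and x0: "x0 \<in> X" and \<tau>0: "\<tau>0 \<in> T"
    using \<delta> by (auto simp: X_def T_def)
  have Q_indep: "Q x (Y x \<tau>) = Q x0 (Y x0 \<tau>)" if "x \<in> X" "\<tau> \<in> T" for x \<tau>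
  proof -
    have "\<exists>c. \<forall>x\<in>X. Q x (Y x \<tau>) = c"
      by (rule has_field_derivative_zero_constant[OF convX])
         (use Q_x that in \<open>auto simp: X T intro: has_field_derivative_at_within\<close>)
    then show ?thesis using that x0 by auto
  qed
  have s_indep: "s x \<tau> = s x0 \<tau>" if "x \<in> X" "\<tau> \<in> T" for x \<tau>
  proof -
    have "((\<lambda>\<tau>. Q x0 (Y x0 \<tau>)) has_real_derivative s x \<tau>) (at \<tau>)"
    proof (rule has_field_derivative_transform_within_open[OF _ openT that(2)])
      show "((\<lambda>\<tau>. Q x (Y x \<tau>)) has_real_derivative s x \<tau>) (at \<tau>)"
        using Q_t that by (simp add: X T)
    qed (rule Q_indep[OF that(1)])
    then show ?thesis
      using Q_t[of x0 \<tau>] that x0 by (simp add: X T DERIV_unique)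
  qed
  have Y_affine: "Y x \<tau> = Y x0 \<tau> + s x0 \<tau> * (x - x0)" if "x \<in> X" "\<tau> \<in> T" for x \<tau>
  proof -
    have "\<exists>c. \<forall>x\<in>X. Y x \<tau> - s x0 \<tau> * x = c"
    proof (rule has_field_derivative_zero_constant[OF convX])
      fix x assume x: "x \<in> X"
      have "((\<lambda>x. Y x \<tau> - s x0 \<tau> * x) has_real_derivative s x \<tau> - s x0 \<tau>) (at x)"
        using Y_x[of x \<tau>] x that by (auto simp: X T intro!: derivative_eq_intros)
      then show "((\<lambda>x. Y x \<tau> - s x0 \<tau> * x) has_real_derivative 0) (at x within X)"
        using s_indep[OF x that(2)] by (auto intro: has_field_derivative_at_within)
    qed
    then have "Y x \<tau> - s x0 \<tau> * x = Y x0 \<tau> - s x0 \<tau> * x0"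
      using that x0 by metis
    then show ?thesis by (simp add: algebra_simps)
  qed
  \<comment> \<open>The slope is a difference quotient in \<open>x\<close> of the differentiable function \<open>Y\<close>, and therefore
    differentiable in \<open>\<tau>\<close>, although \<open>P\<close> and \<open>Q\<close> are only \<open>C\<^sup>1\<close>.\<close>
  define x1 where "x1 = x0 + \<delta> / 2"
  have x1: "x1 \<in> X" "x1 \<noteq> x0" using \<delta> by (auto simp: x1_def X_def)
  define B where "B = (1 / Py x1 (Y x1 \<tau>0) - 1 / Py x0 y0) / (x1 - x0)"
  have s_t: "((\<lambda>\<tau>. s x0 \<tau>) has_real_derivative B) (at \<tau>0)"
  proof (rule has_field_derivative_transform_within_open[OF _ openT \<tau>0])
    show "((\<lambda>\<tau>. (Y x1 \<tau> - Y x0 \<tau>) / (x1 - x0)) has_real_derivative B) (at \<tau>0)"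
      using x1 x0 \<tau>0 Y_t[of x0 \<tau>0] Y_t[of x1 \<tau>0] unfolding B_def
      by (intro DERIV_cdivide DERIV_diff) (auto simp: X T Y0)
    show "(Y x1 \<tau> - Y x0 \<tau>) / (x1 - x0) = s x0 \<tau>" if "\<tau> \<in> T" for \<tau>
      using Y_affine[OF x1(1) that] x1(2) by simp
  qed
  have sm: "s x0 \<tau>0 = m" by (simp add: s_def Y0 m)
  have line: "Y x \<tau>0 = y0 + m * (x - x0)" if "x \<in> X" for x
    using Y_affine[OF that \<tau>0] by (simp add: Y0 sm)
  show ?thesis
  proof (rule exI[of _ \<delta>], rule conjI[OF \<delta>], rule exI[of _ B], intro allI impI conjI)
    fix x assume "\<bar>x - x0\<bar> < \<delta>"
    then have x: "x \<in> X" by (simp add: X)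
    show nz': "Py x (y0 + m * (x - x0)) \<noteq> 0"
      using nz[of x \<tau>0] x \<delta> by (simp add: line[OF x] X)
    show "Px x (y0 + m * (x - x0)) = - m * Py x (y0 + m * (x - x0))"
      using s_indep[OF x \<tau>0] nz' unfolding sm by (simp add: s_def line[OF x] field_simps)
    have "((\<lambda>\<tau>. Y x0 \<tau> + s x0 \<tau> * (x - x0)) has_real_derivative 1 / Py x0 y0 + B * (x - x0)) (at \<tau>0)"
      using s_t Y_t[of x0 \<tau>0] \<delta> by (intro DERIV_add DERIV_cmult_right) (auto simp: Y0)
    then have "((\<lambda>\<tau>. Y x \<tau>) has_real_derivative 1 / Py x0 y0 + B * (x - x0)) (at \<tau>0)"
      by (rule has_field_derivative_transform_within_open[OF _ openT \<tau>0]) (simp add: Y_affine[OF x])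
    moreover have "((\<lambda>\<tau>. Y x \<tau>) has_real_derivative 1 / Py x (y0 + m * (x - x0))) (at \<tau>0)"
      using Y_t[of x \<tau>0] x \<delta> by (simp add: line[OF x] X)
    ultimately show "1 / Py x (y0 + m * (x - x0)) = 1 / Py x0 y0 + B * (x - x0)"
      by (rule DERIV_unique[symmetric])
  qed
qed


text \<open>The local line through a point with \<open>P\<^sub>y \<noteq> 0\<close> extends to a full line of such points. The good
  parameters \<open>S\<close> form an open set, and on the component \<open>C\<close> of the starting point the function
  \<open>q = 1 / P\<^sub>y\<close> is locally affine, hence affine, hence bounded near every finite end of \<open>C\<close>. So \<open>P\<^sub>y\<close>
  cannot vanish at such an end, the end is itself good, and \<open>C\<close> has no ends.\<close>
lemma kernel_line:
  assumes "Py x0 y0 \<noteq> 0" and m: "m = - Px x0 y0 / Py x0 y0"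
  shows "Py x (y0 + m * (x - x0)) \<noteq> 0"
    and "Px x (y0 + m * (x - x0)) = - m * Py x (y0 + m * (x - x0))"
proof -
  define l where "l = (\<lambda>x. y0 + m * (x - x0))"
  define S where "S = {x. Py x (l x) \<noteq> 0 \<and> Px x (l x) = - m * Py x (l x)}"
  define q where "q = (\<lambda>x. 1 / Py x (l x))"
  have local: "\<exists>\<delta> B. \<delta> > 0 \<and> (\<forall>t\<in>ball x \<delta>. t \<in> S \<and> q t = q x + B * (t - x))" if "x \<in> S" for x
  proof -
    have m': "Py x (l x) \<noteq> 0" "m = - Px x (l x) / Py x (l x)"
      using that by (auto simp: S_def)
    have l: "l x + m * (t - x) = l t" for t
      by (simp add: l_def algebra_simps)
    obtain \<delta> B where "\<delta> > 0" and B: "\<forall>t. \<bar>t - x\<bar> < \<delta> \<longrightarrow>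
        Py t (l t) \<noteq> 0 \<and> Px t (l t) = - m * Py t (l t) \<and>
        1 / Py t (l t) = 1 / Py x (l x) + B * (t - x)"
      using local_line[OF m', unfolded l] by blast
    have "\<forall>t\<in>ball x \<delta>. t \<in> S \<and> q t = q x + B * (t - x)"
    proof
      fix t assume "t \<in> ball x \<delta>"
      then have "\<bar>t - x\<bar> < \<delta>" by (simp add: dist_real_def abs_minus_commute)
      with B show "t \<in> S \<and> q t = q x + B * (t - x)"
        unfolding S_def q_def by blast
    qed
    with \<open>\<delta> > 0\<close> show ?thesis by blast
  qed
  define C where "C = connected_component_set S x0"
  have "open S"
    unfolding open_contains_ball using local by blast
  then have "open C"
    unfolding C_def by (rule open_connected_component)
  have "x0 \<in> S" using assms by (simp add: S_def l_def)
  then have "x0 \<in> C" by (simp add: C_def)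
  have "C \<subseteq> S" unfolding C_def by (rule connected_component_subset)
  have "connected C" unfolding C_def by (rule connected_connected_component)
  then have "convex C" by (simp flip: is_interval_connected_1 is_interval_convex_1)
  have q_deriv: "(q has_real_derivative deriv q x) (at x)"
    and q_deriv2: "(deriv q has_real_derivative 0) (at x)" if x: "x \<in> C" for x
  proof -
    obtain \<delta> B where \<delta>: "\<delta> > 0" and B: "\<And>t. t \<in> ball x \<delta> \<Longrightarrow> q t = q x + B * (t - x)"
      using local[of x] x \<open>C \<subseteq> S\<close> by blast
    have *: "(q has_real_derivative B) (at t)" if "t \<in> ball x \<delta>" for t
    proof (rule has_field_derivative_transform_within_open[OF _ open_ball that])
      show "((\<lambda>t. q x + B * (t - x)) has_real_derivative B) (at t)"
        by (auto intro!: derivative_eq_intros)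
    qed (simp add: B)
    have **: "deriv q t = B" if "t \<in> ball x \<delta>" for t
      using *[OF that] by (rule DERIV_imp_deriv)
    show "(q has_real_derivative deriv q x) (at x)"
      using * ** \<delta> by simp
    show "(deriv q has_real_derivative 0) (at x)"
    proof (rule has_field_derivative_transform_within_open)
      show "((\<lambda>t. B) has_real_derivative 0) (at x)" by (rule DERIV_const)
      show "open (ball x \<delta>)" "x \<in> ball x \<delta>" using \<delta> by auto
    qed (rule **[symmetric])
  qed
  define k where "k = deriv q x0"
  have k: "deriv q x = k" if "x \<in> C" for x
    using has_field_derivative_zero_constant[OF \<open>convex C\<close>, of "deriv q"] q_deriv2 that \<open>x0 \<in> C\<close>
    unfolding k_def by (metis has_field_derivative_at_within)
  have q_affine: "q x = q x0 + k * (x - x0)" if "x \<in> C" for x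
  proof -
    have "\<exists>c. \<forall>x\<in>C. q x - k * x = c"
    proof (rule has_field_derivative_zero_constant[OF \<open>convex C\<close>])
      fix x assume x: "x \<in> C"
      have "((\<lambda>x. q x - k * x) has_real_derivative deriv q x - k) (at x)"
        using q_deriv[OF x] by (auto intro!: derivative_eq_intros)
      then show "((\<lambda>x. q x - k * x) has_real_derivative 0) (at x within C)"
        by (simp add: k[OF x] has_field_derivative_at_within)
    qed
    then have "q x - k * x = q x0 - k * x0"
      using that \<open>x0 \<in> C\<close> by metis
    then show ?thesis by (simp add: algebra_simps)
  qed
  have cont: "continuous_on UNIV (\<lambda>x. Px x (l x))" "continuous_on UNIV (\<lambda>x. Py x (l x))"
  proof -
    have "continuous_on UNIV (\<lambda>x. (x, l x))"
      unfolding l_def by (intro continuous_intros)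
    then show "continuous_on UNIV (\<lambda>x. Px x (l x))" "continuous_on UNIV (\<lambda>x. Py x (l x))"
      using continuous_on_compose2[OF Px_cont] continuous_on_compose2[OF Py_cont] by fastforce+
  qed
  \<comment> \<open>\<open>P\<^sub>y \<cdot> q = 1\<close> is written with the affine expression for \<open>q\<close>, which makes sense and is continuous
    also at the ends of \<open>C\<close>.\<close>
  define D where
    "D = {x. Py x (l x) * (q x0 + k * (x - x0)) = 1} \<inter> {x. Px x (l x) = - m * Py x (l x)}"
  have "closed D"
    unfolding D_def by (intro closed_Int closed_Collect_eq continuous_intros cont)
  have "C \<subseteq> D"
    using \<open>C \<subseteq> S\<close> by (auto simp: D_def S_def simp flip: q_affine) (auto simp: q_def)
  then have "closure C \<subseteq> D"
    using \<open>closed D\<close> by (rule closure_minimal)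
  also have "D \<subseteq> S" by (auto simp: D_def S_def)
  finally have "closure C \<subseteq> C"
    using \<open>x0 \<in> C\<close> \<open>connected C\<close> unfolding C_def
    by (intro connected_component_maximal connected_imp_connected_closure)
       (auto intro: closure_subset[THEN subsetD])
  then have "closed C"
    using closure_subset_eq by blast
  then have "C = UNIV"
    using \<open>open C\<close> \<open>x0 \<in> C\<close> clopen[of C] by auto
  then have "x \<in> S" using \<open>C \<subseteq> S\<close> by auto
  then show "Py x (y0 + m * (x - x0)) \<noteq> 0"
    and "Px x (y0 + m * (x - x0)) = - m * Py x (y0 + m * (x - x0))"
    by (auto simp: S_def l_def)
qed

end

section \<open>Maps of the plane with nilpotent derivative\<close>

lemma has_derivative_Pair_vector:
  "((\<lambda>z. vector [fst z, snd z] :: real^2) has_derivative (\<lambda>h. vector [fst h, snd h])) (at z)"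
proof (rule bounded_linear_imp_has_derivative)
  have "linear (\<lambda>h :: real \<times> real. vector [fst h, snd h] :: real^2)"
    by (auto simp: linear_iff vec_eq_iff forall_2)
  then show "bounded_linear (\<lambda>h :: real \<times> real. vector [fst h, snd h] :: real^2)"
    by (simp add: linear_conv_bounded_linear)
qed

text \<open>For \<open>2 \<times> 2\<close> matrices, vanishing trace and determinant together say that \<open>N p\<close> is nilpotent.\<close>
locale nilpotent_map =
  fixes H :: "real^2 \<Rightarrow> real^2" and N :: "real^2 \<Rightarrow> real^2^2"
  assumes H_deriv: "(H has_derivative (\<lambda>h. N p *v h)) (at p)"
    and N_cont: "continuous_on UNIV N"
    and trace_N: "N p $ 1 $ 1 + N p $ 2 $ 2 = 0"
    and det_N: "N p $ 1 $ 1 * N p $ 2 $ 2 = N p $ 1 $ 2 * N p $ 2 $ 1"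
begin

lemma component_deriv:
  "((\<lambda>z. H (vector [fst z, snd z]) $ i) has_derivative
    (\<lambda>h. N (vector [x, y]) $ i $ 1 * fst h + N (vector [x, y]) $ i $ 2 * snd h)) (at (x, y))"
proof -
  have "((\<lambda>z. H (vector [fst z, snd z])) has_derivative
      (\<lambda>h. N (vector [x, y]) *v vector [fst h, snd h])) (at (x, y))"
    using has_derivative_compose[OF has_derivative_Pair_vector H_deriv, of "(x, y)"] by simp
  then have "((\<lambda>z. H (vector [fst z, snd z]) $ i) has_derivative
      (\<lambda>h. (N (vector [x, y]) *v vector [fst h, snd h]) $ i)) (at (x, y))"
    by (rule bounded_linear.has_derivative[OF bounded_linear_vec_nth])
  then show ?thesis
    by (simp add: matrix_vector_mult_def sum_2)
qed

lemma entry_cont: "continuous_on UNIV (\<lambda>z. N (vector [fst z, snd z]) $ i $ j)"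
proof -
  have "continuous_on UNIV (\<lambda>z :: real \<times> real. vector [fst z, snd z] :: real^2)"
    by (intro continuous_at_imp_continuous_on ballI has_derivative_continuous)
       (rule has_derivative_Pair_vector)
  then have "continuous_on UNIV (\<lambda>z :: real \<times> real. N (vector [fst z, snd z]))"
    using continuous_on_compose2[OF N_cont] by fastforce
  then show ?thesis by (intro continuous_on_component)
qed

lemma swapped_entry_cont: "continuous_on UNIV (\<lambda>z. N (vector [snd z, fst z]) $ i $ j)"
  using continuous_on_compose2[OF entry_cont[of i j] continuous_on_swap[of UNIV]]
  by (simp add: prod.swap_def)

sublocale xy: nilpotent_pair
  "\<lambda>x y. H (vector [x, y]) $ 1" "\<lambda>x y. H (vector [x, y]) $ 2"
  "\<lambda>x y. N (vector [x, y]) $ 1 $ 1" "\<lambda>x y. N (vector [x, y]) $ 1 $ 2"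
  "\<lambda>x y. N (vector [x, y]) $ 2 $ 1" "\<lambda>x y. N (vector [x, y]) $ 2 $ 2"
  by unfold_locales (rule component_deriv entry_cont trace_N det_N)+

lemma swapped_component_deriv:
  "((\<lambda>z. H (vector [snd z, fst z]) $ i) has_derivative
    (\<lambda>h. N (vector [y, x]) $ i $ 2 * fst h + N (vector [y, x]) $ i $ 1 * snd h)) (at (x, y))"
proof -
  have "((\<lambda>z. (snd z, fst z)) has_derivative (\<lambda>h. (snd h, fst h))) (at (x, y))"
    by (intro has_derivative_Pair has_derivative_fst has_derivative_snd has_derivative_ident)
  from has_derivative_compose[OF this, of "\<lambda>z. H (vector [fst z, snd z]) $ i", unfolded fst_conv snd_conv,
      OF component_deriv]
  show ?thesis by (simp only: fst_conv snd_conv add.commute)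
qed

text \<open>Exchanging the coordinates in both the domain and the range conjugates the derivative by a
  permutation matrix, so it stays nilpotent. This instance covers points where only the entry
  \<open>N p $ 2 $ 1\<close> is nonzero.\<close>
sublocale yx: nilpotent_pair
  "\<lambda>x y. H (vector [y, x]) $ 2" "\<lambda>x y. H (vector [y, x]) $ 1"
  "\<lambda>x y. N (vector [y, x]) $ 2 $ 2" "\<lambda>x y. N (vector [y, x]) $ 2 $ 1"
  "\<lambda>x y. N (vector [y, x]) $ 1 $ 2" "\<lambda>x y. N (vector [y, x]) $ 1 $ 1"
proof (unfold_locales, goal_cases)
  case (5 x y) then show ?case using trace_N by (simp add: add.commute)
next
  case (6 x y) then show ?case using det_N by (simp add: mult.commute)
qed (rule swapped_component_deriv swapped_entry_cont)+

text \<open>A nonzero nilpotent \<open>2 \<times> 2\<close> matrix has a nonzero off-diagonal entry, so one of the two coordinate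
  versions applies. On the line it gives, the matrix stays nonzero and keeps the kernel it has at \<open>p\<close>.\<close>
lemma kernel_line:
  assumes "N p \<noteq> 0"
  obtains w where "w \<noteq> 0" "\<And>t. N (p + t *\<^sub>R w) \<noteq> 0" "\<And>t. N (p + t *\<^sub>R w) *v w = 0"
proof -
  have p: "vector [p $ 1, p $ 2] = p"
    by (simp add: vec_eq_iff forall_2)
  have "N p $ 1 $ 2 \<noteq> 0 \<or> N p $ 2 $ 1 \<noteq> 0"
  proof (rule ccontr)
    assume *: "\<not> ?thesis"
    then have "N p $ 1 $ 1 = 0 \<and> N p $ 2 $ 2 = 0"
      using det_N[of p] trace_N[of p] by auto
    with * show False using assms by (simp add: vec_eq_iff forall_2)
  qed
  then show thesis
  proof
    assume nz: "N p $ 1 $ 2 \<noteq> 0"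
    define m where "m = - N p $ 1 $ 1 / N p $ 1 $ 2"
    define w :: "real^2" where "w = vector [1, m]"
    have pt: "p + t *\<^sub>R w = vector [p $ 1 + t, p $ 2 + m * (p $ 1 + t - p $ 1)]" for t
      by (simp add: vec_eq_iff forall_2 w_def)
    have *: "N (vector [p $ 1, p $ 2]) $ 1 $ 2 \<noteq> 0"
        "m = - N (vector [p $ 1, p $ 2]) $ 1 $ 1 / N (vector [p $ 1, p $ 2]) $ 1 $ 2"
      using nz by (simp_all add: p m_def)
    have l: "N (p + t *\<^sub>R w) $ 1 $ 2 \<noteq> 0" "N (p + t *\<^sub>R w) $ 1 $ 1 = - m * N (p + t *\<^sub>R w) $ 1 $ 2" for t
      unfolding pt by (rule xy.kernel_line[OF *])+
    show thesis
    proof (rule that[of w])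
      show "w \<noteq> 0" by (simp add: w_def vec_eq_iff forall_2)
      fix t
      show "N (p + t *\<^sub>R w) \<noteq> 0" using l(1)[of t] by auto
      have "N (p + t *\<^sub>R w) $ 2 $ 1 + m * N (p + t *\<^sub>R w) $ 2 $ 2 = 0"
        using l[of t] det_N[of "p + t *\<^sub>R w"] trace_N[of "p + t *\<^sub>R w"] by algebra
      then show "N (p + t *\<^sub>R w) *v w = 0"
        using l(2)[of t] by (simp add: vec_eq_iff forall_2 matrix_vector_mult_def sum_2 w_def mult.commute)
    qed
  next
    assume nz: "N p $ 2 $ 1 \<noteq> 0"
    define m where "m = - N p $ 2 $ 2 / N p $ 2 $ 1"
    define w :: "real^2" where "w = vector [m, 1]"
    have pt: "p + t *\<^sub>R w = vector [p $ 1 + m * (p $ 2 + t - p $ 2), p $ 2 + t]" for t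
      by (simp add: vec_eq_iff forall_2 w_def)
    have *: "N (vector [p $ 1, p $ 2]) $ 2 $ 1 \<noteq> 0"
        "m = - N (vector [p $ 1, p $ 2]) $ 2 $ 2 / N (vector [p $ 1, p $ 2]) $ 2 $ 1"
      using nz by (simp_all add: p m_def)
    have l: "N (p + t *\<^sub>R w) $ 2 $ 1 \<noteq> 0" "N (p + t *\<^sub>R w) $ 2 $ 2 = - m * N (p + t *\<^sub>R w) $ 2 $ 1" for t
      unfolding pt by (rule yx.kernel_line[OF *])+
    show thesis
    proof (rule that[of w])
      show "w \<noteq> 0" by (simp add: w_def vec_eq_iff forall_2)
      fix t
      show "N (p + t *\<^sub>R w) \<noteq> 0" using l(1)[of t] by auto
      have "m * N (p + t *\<^sub>R w) $ 1 $ 1 + N (p + t *\<^sub>R w) $ 1 $ 2 = 0"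
        using l[of t] det_N[of "p + t *\<^sub>R w"] trace_N[of "p + t *\<^sub>R w"] by algebra
      then show "N (p + t *\<^sub>R w) *v w = 0"
        using l(2)[of t] by (simp add: vec_eq_iff forall_2 matrix_vector_mult_def sum_2 w_def mult.commute)
    qed
  qed
qed

text \<open>Two kernel lines with different directions would meet in a point whose matrix is nonzero but
  annihilates two independent vectors. So all kernel lines are parallel. This is where
  it is needed that they are complete lines.\<close>
lemma common_kernel_direction: "\<exists>w. norm w = 1 \<and> (\<forall>p. N p *v w = 0)"
proof (cases "\<forall>p. N p = 0")
  case True
  then have "norm (axis 1 1 :: real^2) = 1 \<and> (\<forall>p. N p *v axis 1 1 = 0)"
    by simp
  then show ?thesis by blast
next
  case False
  then obtain p where "N p \<noteq> 0" by blast
  then obtain w where w: "w \<noteq> 0" "\<And>t. N (p + t *\<^sub>R w) \<noteq> 0" "\<And>t. N (p + t *\<^sub>R w) *v w = 0"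
    by (rule kernel_line) blast
  have "N q *v w = 0" for q
  proof (cases "N q = 0")
    case False
    then obtain v where v: "v \<noteq> 0" "\<And>t. N (q + t *\<^sub>R v) *v v = 0"
      by (rule kernel_line) blast
    define D where "D = w $ 1 * v $ 2 - w $ 2 * v $ 1"
    have "D = 0"
    proof (rule ccontr)
      assume D: "D \<noteq> 0"
      define d where "d = q - p"
      \<comment> \<open>Cramer's rule for the intersection of the lines \<open>p + s w\<close> and \<open>q + t v\<close>.\<close>
      define s where "s = (d $ 1 * v $ 2 - d $ 2 * v $ 1) / D"
      define t where "t = (d $ 1 * w $ 2 - d $ 2 * w $ 1) / D"
      define r where "r = p + s *\<^sub>R w"
      have "s * w $ 1 - t * v $ 1 = d $ 1" "s * w $ 2 - t * v $ 2 = d $ 2"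
        using D by (auto simp: s_def t_def field_simps) (auto simp: D_def algebra_simps)
      then have r: "r = q + t *\<^sub>R v"
        by (simp add: r_def d_def vec_eq_iff forall_2 algebra_simps)
      have "N r *v w = 0" "N r *v v = 0"
        using w(3)[of s] v(2)[of t] by (simp_all flip: r_def r)
      then have *: "N r $ i $ 1 * w $ 1 + N r $ i $ 2 * w $ 2 = 0"
          "N r $ i $ 1 * v $ 1 + N r $ i $ 2 * v $ 2 = 0" for i
        by (simp_all add: vec_eq_iff matrix_vector_mult_def sum_2)
      have "N r $ i $ 1 * D = 0" "N r $ i $ 2 * D = 0" for i
        using *[of i] unfolding D_def by algebra+
      then have "N r = 0"
        using D by (simp add: vec_eq_iff forall_2)
      then show False using w(2)[of s] by (simp add: r_def)
    qed
    have "N q *v v = 0" using v(2)[of 0] by simp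
    then have *: "N q $ i $ 1 * v $ 1 + N q $ i $ 2 * v $ 2 = 0" for i
      by (simp add: vec_eq_iff matrix_vector_mult_def sum_2)
    have "(N q $ i $ 1 * w $ 1 + N q $ i $ 2 * w $ 2) * v $ 1 = 0"
      "(N q $ i $ 1 * w $ 1 + N q $ i $ 2 * w $ 2) * v $ 2 = 0" for i
      using *[of i] \<open>D = 0\<close> unfolding D_def by algebra+
    moreover have "v $ 1 \<noteq> 0 \<or> v $ 2 \<noteq> 0"
      using v(1) by (simp add: vec_eq_iff forall_2)
    ultimately show ?thesis
      by (auto simp: vec_eq_iff matrix_vector_mult_def sum_2)
  qed auto
  then have "N q *v (w /\<^sub>R norm w) = 0" for q
    by (simp add: matrix_vector_mult_scaleR)
  then show ?thesis
    using w(1) by (intro exI[of _ "w /\<^sub>R norm w"]) simp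
qed

text \<open>Let the unit vector \<open>w = (b, -a)\<close> span the common kernel direction, and let \<open>n = (a, b)\<close> be normal
  to it. Then \<open>H\<close> is constant in direction \<open>w\<close>, so it depends on \<open>n \<bullet> p = a x + b y\<close> only. Since a
  nilpotent \<open>2 \<times> 2\<close> matrix killing \<open>w\<close> has its image in the span of \<open>w\<close>, the component \<open>n \<bullet> H\<close> is
  constant, and \<open>H\<close> varies in direction \<open>w\<close> only.\<close>
lemma ridge_form:
  "\<exists>a b \<phi>. \<phi> C1_differentiable_on UNIV \<and>
     (\<forall>p. H p = H 0 + \<phi> (a * p $ 1 + b * p $ 2) *\<^sub>R vector [b, - a])"
proof -
  obtain w where w: "norm w = 1" "\<And>p. N p *v w = 0"
    using common_kernel_direction by blast
  define a where "a = - w $ 2"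
  define b where "b = w $ 1"
  define n :: "real^2" where "n = vector [a, b]"
  have w_ab: "w = vector [b, - a]"
    by (simp add: a_def b_def vec_eq_iff forall_2)
  have ab: "a * a + b * b = 1"
    using w(1) by (simp add: norm_eq_1 inner_vec_def sum_2 w_ab)
  have Nw: "b * N p $ i $ 1 = a * N p $ i $ 2" for p i
    using w(2)[of p] by (simp add: vec_eq_iff matrix_vector_mult_def sum_2 w_ab mult.commute)
  have nN: "n \<bullet> (N p *v h) = 0" for p h
  proof -
    have "a * N p $ 1 $ 1 + b * N p $ 2 $ 1 = 0" "a * N p $ 1 $ 2 + b * N p $ 2 $ 2 = 0"
      using Nw[of p 1] Nw[of p 2] trace_N[of p] by algebra+
    moreover have "n \<bullet> (N p *v h) =
        (a * N p $ 1 $ 1 + b * N p $ 2 $ 1) * h $ 1 + (a * N p $ 1 $ 2 + b * N p $ 2 $ 2) * h $ 2"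
      by (simp add: n_def inner_vec_def sum_2 matrix_vector_mult_def algebra_simps)
    ultimately show ?thesis by simp
  qed
  have nH: "n \<bullet> H p = n \<bullet> H q" for p q
  proof (rule has_derivative_zero_unique[of UNIV "\<lambda>p. n \<bullet> H p"])
    fix p
    show "((\<lambda>p. n \<bullet> H p) has_derivative (\<lambda>h. 0)) (at p within UNIV)"
      using has_derivative_inner_right[OF H_deriv[of p], of n] by (simp add: nN)
  qed auto
  have Hw: "H (p + t *\<^sub>R w) = H p" for p t
  proof -
    have "H (p + t *\<^sub>R w) = H (p + 0 *\<^sub>R w)"
    proof (rule has_derivative_zero_unique[of UNIV "\<lambda>t. H (p + t *\<^sub>R w)"])
      fix t
      have "((\<lambda>t. p + t *\<^sub>R w) has_derivative (\<lambda>h. h *\<^sub>R w)) (at t)"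
        by (auto intro!: derivative_eq_intros)
      from has_derivative_compose[OF this H_deriv]
      show "((\<lambda>t. H (p + t *\<^sub>R w)) has_derivative (\<lambda>h. 0)) (at t within UNIV)"
        by (simp add: matrix_vector_mult_scaleR w(2))
    qed auto
    then show ?thesis by simp
  qed
  have decompose: "p = (n \<bullet> p) *\<^sub>R n + (w \<bullet> p) *\<^sub>R w" for p
  proof -
    have "p $ 1 = (a * p $ 1 + b * p $ 2) * a + (b * p $ 1 - a * p $ 2) * b"
      "p $ 2 = (a * p $ 1 + b * p $ 2) * b - (b * p $ 1 - a * p $ 2) * a"
      using ab by algebra+
    then show ?thesis
      by (simp add: vec_eq_iff forall_2 n_def w_ab inner_vec_def sum_2)
  qed
  define \<phi> where "\<phi> = (\<lambda>t. w \<bullet> (H (t *\<^sub>R n) - H 0))"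
  have "H p = H 0 + \<phi> (a * p $ 1 + b * p $ 2) *\<^sub>R vector [b, - a]" for p
  proof -
    have "H p = H ((n \<bullet> p) *\<^sub>R n)"
      using Hw[of "(n \<bullet> p) *\<^sub>R n" "w \<bullet> p"] unfolding decompose[symmetric] .
    moreover have "H ((n \<bullet> p) *\<^sub>R n) - H 0 = \<phi> (n \<bullet> p) *\<^sub>R w"
    proof -
      have "n \<bullet> (H ((n \<bullet> p) *\<^sub>R n) - H 0) = 0"
        using nH[of "(n \<bullet> p) *\<^sub>R n" 0] unfolding inner_diff_right by (rule iffD2[OF right_minus_eq])
      with decompose[of "H ((n \<bullet> p) *\<^sub>R n) - H 0"] show ?thesis
        unfolding \<phi>_def by (metis scaleR_zero_left add_0)
    qed
    moreover have "n \<bullet> p = a * p $ 1 + b * p $ 2"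
      by (simp add: n_def inner_vec_def sum_2)
    ultimately show ?thesis by (simp add: w_ab algebra_simps)
  qed
  moreover have "\<phi> C1_differentiable_on UNIV"
    unfolding C1_differentiable_on_def
  proof (intro exI conjI ballI)
    fix t
    have "((\<lambda>t. t *\<^sub>R n) has_derivative (\<lambda>h. h *\<^sub>R n)) (at t)"
      by (auto intro!: derivative_eq_intros)
    from has_derivative_compose[OF this H_deriv]
    have "((\<lambda>t. H (t *\<^sub>R n) - H 0) has_derivative (\<lambda>h. h *\<^sub>R (N (t *\<^sub>R n) *v n))) (at t)"
      by (auto intro!: derivative_eq_intros simp: matrix_vector_mult_scaleR)
    from has_derivative_inner_right[OF this, of w]
    show "(\<phi> has_vector_derivative w \<bullet> (N (t *\<^sub>R n) *v n)) (at t)"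
      by (simp add: \<phi>_def has_vector_derivative_def)
  next
    have "continuous_on UNIV (\<lambda>t. N (t *\<^sub>R n))"
      by (rule continuous_on_compose2[OF N_cont]) (auto intro!: continuous_intros)
    then show "continuous_on UNIV (\<lambda>t. w \<bullet> (N (t *\<^sub>R n) *v n))"
      unfolding matrix_vector_mult_def
      by (intro continuous_intros continuous_on_vec_lambda continuous_on_component)
  qed
  ultimately show ?thesis by blast
qed

end

section \<open>Unipotence in terms of trace and determinant\<close>

lemma eigenvalue_of_iff_det:
  "eigenvalue_of A z \<longleftrightarrow> det ((\<chi> i j. complex_of_real (A $ i $ j)) - mat z) = 0"
proof -
  let ?A = "\<chi> i j. complex_of_real (A $ i $ j)"
  have *: "mat z *v v = z *s v" for v :: "complex^'n"
    by (simp add: vec_eq_iff matrix_vector_mult_def mat_def if_distrib[of "\<lambda>x. x * _"] cong: if_cong)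
  then have "eigenvalue_of A z \<longleftrightarrow> (\<exists>v. v \<noteq> 0 \<and> (?A - mat z) *v v = 0)"
    by (simp only: eigenvalue_of_def matrix_vector_mult_diff_rdistrib * right_minus_eq)
  also have "\<dots> \<longleftrightarrow> \<not> invertible (?A - mat z)"
    using matrix_left_invertible_ker[of "?A - mat z"] invertible_left_inverse[of "?A - mat z"] by blast
  finally show ?thesis by (simp add: invertible_det_nz)
qed

lemma eigenvalue_of_2_iff:
  fixes A :: "real^2^2"
  shows "eigenvalue_of A z \<longleftrightarrow>
    z\<^sup>2 - of_real (A $ 1 $ 1 + A $ 2 $ 2) * z + of_real (det A) = 0"
  unfolding eigenvalue_of_iff_det det_2
  by (simp add: mat_def algebra_simps power2_eq_square)

text \<open>Over the complex numbers the characteristic polynomial has both roots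
  \<open>(T \<plusminus> r) / 2\<close>; if both are 1, then their sum and product give the trace and the determinant.\<close>
lemma all_eigenvalues_1_iff:
  fixes A :: "real^2^2"
  shows "(\<forall>z. eigenvalue_of A z \<longrightarrow> z = 1) \<longleftrightarrow> A $ 1 $ 1 + A $ 2 $ 2 = 2 \<and> det A = 1"
proof
  assume *: "\<forall>z. eigenvalue_of A z \<longrightarrow> z = 1"
  define T where "T = complex_of_real (A $ 1 $ 1 + A $ 2 $ 2)"
  define D where "D = complex_of_real (det A)"
  define r where "r = csqrt (T\<^sup>2 - 4 * D)"
  have r: "r\<^sup>2 = T\<^sup>2 - 4 * D" by (simp add: r_def)
  have root: "z = 1" if "z\<^sup>2 - T * z + D = 0" for z
    using * that unfolding eigenvalue_of_2_iff T_def D_def by blast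
  have "((T + r) / 2)\<^sup>2 - T * ((T + r) / 2) + D = 0" "((T - r) / 2)\<^sup>2 - T * ((T - r) / 2) + D = 0"
    using r by (simp add: power2_eq_square field_simps, algebra)+
  then have "(T + r) / 2 = 1" "(T - r) / 2 = 1"
    by (blast intro: root)+
  then have Tr: "T + r = 2" "T - r = 2" by simp_all
  have "2 * T = (T + r) + (T - r)" by simp
  then have T: "T = 2" unfolding Tr by simp
  with Tr have "r = 0" by simp
  with r T have D: "D = 1" by simp
  show "A $ 1 $ 1 + A $ 2 $ 2 = 2 \<and> det A = 1"
    using T D unfolding T_def D_def
    by (metis of_real_1 of_real_eq_iff of_real_numeral)
next
  assume *: "A $ 1 $ 1 + A $ 2 $ 2 = 2 \<and> det A = 1"
  show "\<forall>z. eigenvalue_of A z \<longrightarrow> z = 1"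
  proof (intro allI impI)
    fix z assume "eigenvalue_of A z"
    then have "z\<^sup>2 - 2 * z + 1 = 0"
      unfolding eigenvalue_of_2_iff using * by simp
    moreover have "(z - 1)\<^sup>2 = z\<^sup>2 - 2 * z + 1" by (simp add: power2_diff)
    ultimately have "(z - 1)\<^sup>2 = 0" by simp
    then show "z = 1" by simp
  qed
qed

lemma unipotent_jacobian_2_iff:
  fixes f :: "real^2 \<Rightarrow> real^2"
  shows "unipotent_jacobian f \<longleftrightarrow>
    (\<forall>p. jacobian f (at p) $ 1 $ 1 + jacobian f (at p) $ 2 $ 2 = 2 \<and> det (jacobian f (at p)) = 1)"
  unfolding unipotent_jacobian_def all_eigenvalues_1_iff[symmetric] by blast

section \<open>Shear maps\<close>

text \<open>The shear can be differentiable when \<open>\<phi>\<close> is not (for \<open>a = b = 0\<close>, every \<open>\<phi>\<close> gives a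
  translation), so the chain rule is not available. Instead two identities free of \<open>\<phi>\<close> are differentiated: \<open>a f\<^sub>1 + b f\<^sub>2 = a x + b y + const\<close>
  and \<open>f (p + t w) = f p + t w\<close> for \<open>w = (b, -a)\<close>. If \<open>(a, b) \<noteq> 0\<close>, they give
  a left and a right eigenvector of the Jacobian matrix for the eigenvalue 1, orthogonal to each
  other, and this determines trace and determinant.\<close>
lemma shear_form_unipotent:
  assumes diff: "\<And>p. shear_form a b c d \<phi> differentiable (at p)"
  shows "unipotent_jacobian (shear_form a b c d \<phi>)"
  unfolding unipotent_jacobian_2_iff
proof
  fix p
  let ?f = "shear_form a b c d \<phi>"
  define J where "J = jacobian ?f (at p)"
  have J: "(?f has_derivative (\<lambda>h. J *v h)) (at p)"
    using diff[of p] by (simp add: jacobian_works J_def)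
  have row: "vector [a, b] \<bullet> (J *v h) = vector [a, b] \<bullet> h" for h :: "real^2"
  proof -
    have "(\<lambda>q. vector [a, b] \<bullet> ?f q) = (\<lambda>q. vector [a, b] \<bullet> q + (a * c + b * d))"
      by (simp add: fun_eq_iff shear_form_def inner_vec_def sum_2 algebra_simps)
    moreover have "((\<lambda>q. vector [a, b] \<bullet> q + (a * c + b * d)) has_derivative
        (\<lambda>h :: real^2. vector [a, b] \<bullet> h)) (at p)"
      by (auto intro!: derivative_eq_intros)
    ultimately have "((\<lambda>q. vector [a, b] \<bullet> ?f q) has_derivative (\<lambda>h. vector [a, b] \<bullet> h)) (at p)"
      by simp
    with has_derivative_inner_right[OF J, of "vector [a, b]"] show ?thesis
      by (metis has_derivative_unique)
  qed
  define w :: "real^2" where "w = vector [b, - a]"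
  have col: "J *v w = w"
  proof -
    have "(\<lambda>t. ?f (p + t *\<^sub>R w)) = (\<lambda>t. ?f p + t *\<^sub>R w)"
      by (simp add: fun_eq_iff shear_form_def vec_eq_iff forall_2 w_def algebra_simps)
    moreover have "((\<lambda>t. ?f p + t *\<^sub>R w) has_derivative (\<lambda>t. t *\<^sub>R w)) (at 0)"
      by (auto intro!: derivative_eq_intros)
    ultimately have 1: "((\<lambda>t. ?f (p + t *\<^sub>R w)) has_derivative (\<lambda>t. t *\<^sub>R w)) (at 0)"
      by simp
    have "((\<lambda>t. p + t *\<^sub>R w) has_derivative (\<lambda>t. t *\<^sub>R w)) (at 0)"
      by (auto intro!: derivative_eq_intros)
    then have "((\<lambda>t. ?f (p + t *\<^sub>R w)) has_derivative (\<lambda>t. J *v (t *\<^sub>R w))) (at 0)"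
      by (rule has_derivative_compose) (use J in simp)
    with 1 have "(\<lambda>t. J *v (t *\<^sub>R w)) = (\<lambda>t. t *\<^sub>R w)"
      by (metis has_derivative_unique)
    from fun_cong[OF this, of 1] show ?thesis by simp
  qed
  define j11 j12 j21 j22 where j: "j11 = J $ 1 $ 1" "j12 = J $ 1 $ 2" "j21 = J $ 2 $ 1" "j22 = J $ 2 $ 2"
  have eqs: "a * j11 + b * j21 = a" "a * j12 + b * j22 = b"
    "j11 * b - j12 * a = b" "j21 * b - j22 * a = - a"
    using row[of "axis 1 1"] row[of "axis 2 1"] col
    by (simp_all add: j inner_vec_def sum_2 matrix_vector_mult_def axis_def vec_eq_iff forall_2 w_def)
  show "jacobian ?f (at p) $ 1 $ 1 + jacobian ?f (at p) $ 2 $ 2 = 2 \<and> det (jacobian ?f (at p)) = 1"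
  proof (cases "a = 0 \<and> b = 0")
    case True
    then have "?f = (\<lambda>q. q + vector [c, d])"
      by (simp add: fun_eq_iff shear_form_def vec_eq_iff forall_2)
    then have "(?f has_derivative (\<lambda>h. h)) (at p)"
      by (auto intro!: derivative_eq_intros)
    with J have "(\<lambda>h. J *v h) = (\<lambda>h. h)"
      by (metis has_derivative_unique)
    then have "J *v h = mat 1 *v h" for h by (simp add: fun_eq_iff)
    then have "J = mat 1" by (simp add: matrix_eq)
    then show ?thesis by (simp add: mat_def det_2 flip: J_def)
  next
    case False
    have "(j11 + j22 - 2) * a = (a * j11 + b * j21 - a) - (j21 * b - j22 * a + a)"
      "(j11 + j22 - 2) * b = (j11 * b - j12 * a - b) + (a * j12 + b * j22 - b)"
      by (simp_all add: algebra_simps)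
    then have tr: "j11 + j22 = 2" using False by (auto simp: eqs)
    have "(j11 * j22 - j12 * j21 - 1) * a =
        j22 * (a * j11 + b * j21 - a) - j21 * (a * j12 + b * j22 - b) - (j21 * b - j22 * a + a)"
      "(j11 * j22 - j12 * j21 - 1) * b =
        j22 * (j11 * b - j12 * a - b) - j12 * (j21 * b - j22 * a + a) + (a * j12 + b * j22 - b)"
      by (simp_all add: algebra_simps)
    then have "j11 * j22 - j12 * j21 = 1" using False by (auto simp: eqs)
    with tr show ?thesis by (simp add: det_2 j J_def)
  qed
qed

text \<open>Here \<open>t\<close> recovers the argument \<open>a x + b y\<close> of \<open>\<phi>\<close> from the image point, since the two occurrences
  of \<open>\<phi>\<close> cancel in \<open>a f\<^sub>1 + b f\<^sub>2\<close>.\<close>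
definition shear_form_inverse ::
  "real \<Rightarrow> real \<Rightarrow> real \<Rightarrow> real \<Rightarrow> (real \<Rightarrow> real) \<Rightarrow> real^2 \<Rightarrow> real^2" where
  "shear_form_inverse a b c d \<phi> q =
     (let t = a * q $ 1 + b * q $ 2 - (a * c + b * d)
      in vector [q $ 1 - b * \<phi> t - c, q $ 2 + a * \<phi> t - d])"

lemma shear_form_inverse:
  "shear_form_inverse a b c d \<phi> (shear_form a b c d \<phi> p) = p"
  "shear_form a b c d \<phi> (shear_form_inverse a b c d \<phi> q) = q"
proof -
  have 1: "a * (x + b * s + c) + b * (y - a * s + d) - (a * c + b * d) = a * x + b * y" for x y s
    by algebra
  have 2: "a * (x - b * s - c) + b * (y + a * s - d) = a * x + b * y - (a * c + b * d)" for x y s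
    by algebra
  show "shear_form_inverse a b c d \<phi> (shear_form a b c d \<phi> p) = p"
    by (simp add: shear_form_inverse_def shear_form_def 1 Let_def vec_eq_iff forall_2)
  show "shear_form a b c d \<phi> (shear_form_inverse a b c d \<phi> q) = q"
    by (simp add: shear_form_inverse_def shear_form_def 2 Let_def vec_eq_iff forall_2)
qed

lemma bij_shear_form: "bij (shear_form a b c d \<phi>)"
  by (rule o_bij[of "shear_form_inverse a b c d \<phi>"]) (auto simp: fun_eq_iff shear_form_inverse)

lemma inv_shear_form: "inv (shear_form a b c d \<phi>) = shear_form_inverse a b c d \<phi>"
  by (rule inv_unique_comp) (auto simp: fun_eq_iff shear_form_inverse)

lemma explicit_map_inv_shear_form:
  "explicit_map {a, b, c, d} {\<phi>} (inv (shear_form a b c d \<phi>))"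
proof -
  let ?E = "explicit_fun {a, b, c, d} {\<phi>} :: (real^2 \<Rightarrow> real) \<Rightarrow> bool"
  have "?E (\<lambda>q. q $ 1 - b * \<phi> (a * q $ 1 + b * q $ 2 - (a * c + b * d)) - c)"
    "?E (\<lambda>q. q $ 2 + a * \<phi> (a * q $ 1 + b * q $ 2 - (a * c + b * d)) - d)"
    by (intro explicit_fun.add explicit_fun.diff explicit_fun.mult explicit_fun.coord
        explicit_fun.const explicit_fun.comp[of \<phi>]; simp)+
  then show ?thesis
    by (simp add: explicit_map_def inv_shear_form shear_form_inverse_def forall_2 Let_def)
qed

section \<open>Unipotent Jacobians and shear maps\<close>

theorem theorem5p1:
  fixes f :: "real^2 \<Rightarrow> real^2"
  assumes "C1_map f"
  shows "(\<forall>a b c d \<phi>. f = shear_form a b c d \<phi> \<longrightarrow>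
            unipotent_jacobian f \<and> bij f \<and> explicit_map {a, b, c, d} {\<phi>} (inv f)) \<and>
         (unipotent_jacobian f \<longrightarrow>
            (\<exists>a b c d \<phi>. \<phi> C1_differentiable_on UNIV \<and> f = shear_form a b c d \<phi>))"
proof (intro conjI allI impI)
  fix a b c d \<phi>
  assume f: "f = shear_form a b c d \<phi>"
  show "unipotent_jacobian f"
    using assms unfolding f C1_map_def by (intro shear_form_unipotent) blast
  show "bij f"
    unfolding f by (rule bij_shear_form)
  show "explicit_map {a, b, c, d} {\<phi>} (inv f)"
    unfolding f by (rule explicit_map_inv_shear_form)
next
  assume uni: "unipotent_jacobian f"
  interpret nilpotent_map "\<lambda>p. f p - p" "\<lambda>p. jacobian f (at p) - mat 1"
  proof
    fix p
    have "(f has_derivative (\<lambda>h. jacobian f (at p) *v h)) (at p)"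
      using assms by (simp add: C1_map_def flip: jacobian_works)
    then show "((\<lambda>p. f p - p) has_derivative (\<lambda>h. (jacobian f (at p) - mat 1) *v h)) (at p)"
      by (auto intro!: derivative_eq_intros simp: matrix_vector_mult_diff_rdistrib)
    show "continuous_on UNIV (\<lambda>p. jacobian f (at p) - mat 1)"
      using assms by (intro continuous_intros) (simp add: C1_map_def)
    let ?J = "jacobian f (at p)"
    have J: "?J $ 1 $ 1 + ?J $ 2 $ 2 = 2" "?J $ 1 $ 1 * ?J $ 2 $ 2 - ?J $ 1 $ 2 * ?J $ 2 $ 1 = 1"
      using uni by (simp_all add: unipotent_jacobian_2_iff det_2)
    then show "(?J - mat 1) $ 1 $ 1 + (?J - mat 1) $ 2 $ 2 = 0"
      by (simp add: mat_def)
    have "(?J $ 1 $ 1 - 1) * (?J $ 2 $ 2 - 1) = ?J $ 1 $ 2 * ?J $ 2 $ 1"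
      using J by (simp add: algebra_simps)
    then show "(?J - mat 1) $ 1 $ 1 * (?J - mat 1) $ 2 $ 2 = (?J - mat 1) $ 1 $ 2 * (?J - mat 1) $ 2 $ 1"
      by (simp add: mat_def)
  qed
  obtain a b \<phi> where \<phi>: "\<phi> C1_differentiable_on UNIV"
    and *: "\<And>p. f p - p = f 0 + \<phi> (a * p $ 1 + b * p $ 2) *\<^sub>R vector [b, - a]"
    using ridge_form by auto
  have "f p = shear_form a b (f 0 $ 1) (f 0 $ 2) \<phi> p" for p
  proof -
    have "f p = p + (f 0 + \<phi> (a * p $ 1 + b * p $ 2) *\<^sub>R vector [b, - a])"
      using *[of p] by (simp add: algebra_simps)
    then show ?thesis
      by (simp add: shear_form_def vec_eq_iff forall_2 mult.commute)
  qed
  with \<phi> show "\<exists>a b c d \<phi>. \<phi> C1_differentiable_on UNIV \<and> f = shear_form a b c d \<phi>"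
    by blast
qed

end
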